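(* For all nonnegative integers $m$ and $n$, $$\sum_{k=0}^m 2^k\binom{2m-k}{m+n}=4^m-\sum_{j=1}^n\binom{2m+1}{m+j}.$$
   Context: For nonnegative integers $a,b$, $\binom{a}{b}$ is the usual binomial coefficient, with $\binom{a}{b}=0$ when $b>a$. An empty sum (the sum over $j$ when $n=0$) equals $0$. The identity is between integers (the right-hand side uses ordinary, not truncated, subtraction). *)

theory Defs
  imports Complex_Main
begin

end

(* Grouping the (r+1)-or-larger subsets of an (N+1)-set by the position of their (r+1)-st element shows
   that the sum of 2^k * C(N-k, r) over k <= N counts those subsets, so it complements the partial row sum
   of C(N+1, i) over i <= r. For N = 2m and r = m + n the terms with k > m vanish, and
   half of row 2m+1 sums to 4^m. *)
theory Submission
  imports Defs
begin

text \<open>By Pascal's rule each \<open>N choose i\<close> with i < r enters the sum over the next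
  row twice, but \<open>N choose r\<close> only once; the added term is its missing copy.\<close>

lemma sum_choose_atMost_Suc_row:
  "(\<Sum>i\<le>r. Suc N choose i) + (N choose r) = 2 * (\<Sum>i\<le>r. N choose i)"
  by (induction r) auto

text \<open>Induction replaces the counting: as N grows by one, both sums double, up to a correction
  \<open>Suc N choose r\<close> that is added in the first (its term k = 0) and subtracted in the
  second, so the total doubles.\<close>

lemma sum_power2_choose_plus_partial_row_sum:
  "(\<Sum>k\<le>N. 2 ^ k * ((N - k) choose r)) + (\<Sum>i\<le>r. Suc N choose i) = 2 ^ Suc N"
proof (induction N)
  case 0
  show ?case
    by (induction r) auto
next
  case (Suc N)
  have "(\<Sum>k\<le>Suc N. 2 ^ k * ((Suc N - k) choose r))
      = (Suc N choose r) + 2 * (\<Sum>k\<le>N. 2 ^ k * ((N - k) choose r))"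
    by (simp add: sum.atMost_Suc_shift sum_distrib_left mult.assoc del: sum.atMost_Suc)
  with Suc.IH sum_choose_atMost_Suc_row[of "Suc N" r] show ?case
    by simp
qed

theorem mainTheorem2:
  fixes m n :: nat
  shows "(\<Sum>k=0..m. 2 ^ k * int ((2 * m - k) choose (m + n)))
    = 4 ^ m - (\<Sum>j=1..n. int ((2 * m + 1) choose (m + j)))"
proof -
  have trunc: "(\<Sum>k=0..m. 2 ^ k * ((2 * m - k) choose (m + n)))
      = (\<Sum>k\<le>2 * m. 2 ^ k * ((2 * m - k) choose (m + n)))"
    by (rule sum.mono_neutral_left) (auto simp: binomial_eq_0)
  have split: "(\<Sum>i\<le>m + n. (2 * m + 1) choose i)
      = 4 ^ m + (\<Sum>j=1..n. (2 * m + 1) choose (m + j))"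
  proof (induction n)
    case 0
    show ?case
      using binomial_r_part_sum[of m] by (simp add: power_mult)
  qed simp
  \<comment> \<open>The total is 2 * 4 ^ m, and \<open>split\<close> accounts for one 4 ^ m. The
    additive form avoids truncated subtraction before the passage to \<open>int\<close>.\<close>
  have "(\<Sum>k=0..m. 2 ^ k * ((2 * m - k) choose (m + n)))
      + (\<Sum>j=1..n. (2 * m + 1) choose (m + j)) = 4 ^ m"
    using sum_power2_choose_plus_partial_row_sum[of "2 * m" "m + n"] trunc split
    by (simp add: power_mult)
  then have "int ((\<Sum>k=0..m. 2 ^ k * ((2 * m - k) choose (m + n)))
      + (\<Sum>j=1..n. (2 * m + 1) choose (m + j))) = 4 ^ m"
    by simp
  then show ?thesis
    by simp
qed

end
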